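(* Let $\alpha\ge1$, $\beta>0$, $\gamma>0$. Every $(\alpha,\beta,\gamma)$-greedy algorithm for MinSet under stochastic explorable uncertainty satisfies, on every instance, $\mathbb{E}[\mathrm{ALG}]\le\alpha\cdot\beta\cdot\bar\rho(\gamma)\cdot\mathbb{E}[\mathrm{OPT}]$, i.e., it achieves competitive ratio $\alpha\cdot\beta\cdot\bar\rho(\gamma)$, where $\bar\rho(\gamma)=\lceil\ln(\gamma\cdot m\cdot\max_{S,S'\in\mathcal{S}}(U_S-L_{S'}))\rceil+\lceil\ln m\rceil$; this is $\mathcal{O}(\alpha\beta\log m)$ when $\gamma$ and the interval limits are regarded as constants.
   Context: An instance of MinSet under stochastic explorable uncertainty consists of intervals $\mathcal{I}=\{I_1,\dots,I_n\}$, each open $(L_i,U_i)$ with $L_i<U_i$ or trivial $\{w_i\}$ with $L_i=U_i=w_i$, and a family $\mathcal{S}$ of $m$ subsets of $\mathcal{I}$. Values $w_i\in I_i$ are drawn independently from distributions unknown to the algorithm; querying $I_i$ reveals $w_i$. Let $L_S=\sum_{I_i\in S}L_i$, $U_S=\sum_{I_i\in S}U_i$, $w(S)=\sum_{I_i\in S}w_i$, $w^*=\min_S w(S)$. For a realization, let $a_i=w_i-L_i$, $b_S=w^*-L_S$; a set $Q\subseteq\mathcal{I}$ is feasible if $\sum_{I_i\in S\cap Q}a_i\ge b_S$ for all $S\in\mathcal{S}$ (equivalently, the MinSet instance is solved after querying $Q$); $\mathrm{OPT}$ is the minimum cardinality of a feasible set, and $\mathrm{ALG}$ the number of queries of the algorithm,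 which queries until its queried set is feasible. For $\gamma>0$ and $Q\subseteq\mathcal{I}$: $b'_S(Q)=\max\{\gamma b_S-\sum_{I_i\in Q\cap S}\gamma a_i,0\}$, $b'(Q)=\sum_S b'_S(Q)$, $A(Q)=|\{S: b'_S(Q)>0\}|$. A set $G\subseteq\mathcal{I}\setminus Q$ $\alpha$-approximates the greedy choice after adding $Q$ (for the instance scaled by $\gamma$) if either $A(Q\cup G)\le(1-\frac{1}{\alpha\mathrm{OPT}})A(Q)$, or $b'(Q)\ge1$ and $b'(Q\cup G)\le(1-\frac{1}{\alpha\mathrm{OPT}})b'(Q)$. An iterative algorithm queries, in iterations $j=1,2,\dots$, pairwise disjoint sets $G_1,G_2,\dots\subseteq\mathcal{I}$ (chosen adaptively, possibly depending on earlier query results) until the instance is solved; $Q_j=\bigcup_{j'<j}G_{j'}$, $X_j=|G_j|$ (with $X_j=0$ if iteration $j$ is not executed), and $Y_j\in\{0,1\}$ indicates whether iteration $j$ is executed. It is $(\alpha,\beta,\gamma)$-greedy if (1) for every realization of values, each $G_j$ $\alpha$-approximates the greedy choice after adding $Q_j$ for the instance scaled by $\gamma$, and (2) $\mathbb{E}[X_j\mid Y_j=1]\le\beta$ for all $j$.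
   Formalization: Assumes in addition that ⌈ln(γ·m·max(U_S−L_{S'}))⌉ ≥ 0 and that ρ̄(γ) > 0; without these the claim fails, e.g. for m = 1, one interval (0,1), α = β = γ = 1, where ALG = OPT = 1 but ρ̄ = 0. *)

theory Defs
  imports "HOL-Probability.Probability" "HOL-Library.Landau_Symbols"
begin

section \<open>MinSet instances\<close>

text \<open>
  The intervals are identified with their indices \<open>1, \<dots>, n\<close>, so subsets of the collection of
  intervals are sets of indices (and two intervals may have the same endpoints).
\<close>

record minset =
  num_intervals :: nat
  lower :: "nat \<Rightarrow> real"
  upper :: "nat \<Rightarrow> real"
  family :: "nat set set"

definition indices :: "minset \<Rightarrow> nat set" where
  "indices P = {1..num_intervals P}"

definition minset_instance :: "minset \<Rightarrow> bool" where
  "minset_instance P \<longleftrightarrow>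
     (\<forall>i\<in>indices P. lower P i \<le> upper P i) \<and> family P \<noteq> {} \<and> family P \<subseteq> Pow (indices P)"

definition interval :: "minset \<Rightarrow> nat \<Rightarrow> real set" where
  "interval P i = (if lower P i = upper P i then {lower P i} else {lower P i<..<upper P i})"

definition realizations :: "minset \<Rightarrow> (nat \<Rightarrow> real) set" where
  "realizations P = (\<Pi>\<^sub>E i\<in>indices P. interval P i)"

definition set_lower :: "minset \<Rightarrow> nat set \<Rightarrow> real" where
  "set_lower P S = (\<Sum>i\<in>S. lower P i)"

definition set_upper :: "minset \<Rightarrow> nat set \<Rightarrow> real" where
  "set_upper P S = (\<Sum>i\<in>S. upper P i)"

definition max_gap :: "minset \<Rightarrow> real" where
  "max_gap P = Max {set_upper P S - set_lower P S' | S S'. S \<in> family P \<and> S' \<in> family P}"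

definition min_value :: "minset \<Rightarrow> (nat \<Rightarrow> real) \<Rightarrow> real" where
  "min_value P w = Min {(\<Sum>i\<in>S. w i) | S. S \<in> family P}"

definition coeff_a :: "minset \<Rightarrow> (nat \<Rightarrow> real) \<Rightarrow> nat \<Rightarrow> real" where
  "coeff_a P w i = w i - lower P i"

definition coeff_b :: "minset \<Rightarrow> (nat \<Rightarrow> real) \<Rightarrow> nat set \<Rightarrow> real" where
  "coeff_b P w S = min_value P w - set_lower P S"

definition feasible :: "minset \<Rightarrow> (nat \<Rightarrow> real) \<Rightarrow> nat set \<Rightarrow> bool" where
  "feasible P w Q \<longleftrightarrow> Q \<subseteq> indices P \<and>
     (\<forall>S\<in>family P. (\<Sum>i\<in>S \<inter> Q. coeff_a P w i) \<ge> coeff_b P w S)"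

definition OPT :: "minset \<Rightarrow> (nat \<Rightarrow> real) \<Rightarrow> nat" where
  "OPT P w = Min {card Q | Q. feasible P w Q}"


section \<open>Approximate greedy choices\<close>

definition residual :: "real \<Rightarrow> minset \<Rightarrow> (nat \<Rightarrow> real) \<Rightarrow> nat set \<Rightarrow> nat set \<Rightarrow> real" where
  "residual \<gamma> P w Q S = max (\<gamma> * coeff_b P w S - (\<Sum>i\<in>Q \<inter> S. \<gamma> * coeff_a P w i)) 0"

definition total_residual :: "real \<Rightarrow> minset \<Rightarrow> (nat \<Rightarrow> real) \<Rightarrow> nat set \<Rightarrow> real" where
  "total_residual \<gamma> P w Q = (\<Sum>S\<in>family P. residual \<gamma> P w Q S)"

definition num_unsatisfied :: "real \<Rightarrow> minset \<Rightarrow> (nat \<Rightarrow> real) \<Rightarrow> nat set \<Rightarrow> nat" where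
  "num_unsatisfied \<gamma> P w Q = card {S \<in> family P. residual \<gamma> P w Q S > 0}"

definition approximates_greedy ::
    "real \<Rightarrow> real \<Rightarrow> minset \<Rightarrow> (nat \<Rightarrow> real) \<Rightarrow> nat set \<Rightarrow> nat set \<Rightarrow> bool" where
  "approximates_greedy \<alpha> \<gamma> P w Q G \<longleftrightarrow> G \<subseteq> indices P - Q \<and>
     (real (num_unsatisfied \<gamma> P w (Q \<union> G))
        \<le> (1 - 1 / (\<alpha> * real (OPT P w))) * real (num_unsatisfied \<gamma> P w Q) \<or>
      total_residual \<gamma> P w Q \<ge> 1 \<and>
      total_residual \<gamma> P w (Q \<union> G)
        \<le> (1 - 1 / (\<alpha> * real (OPT P w))) * total_residual \<gamma> P w Q)"


section \<open>Iterative adaptive algorithms\<close>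

text \<open>
  A transcript lists the queried intervals with the revealed values, in the order of the queries.
  An algorithm sees the transcripts of all completed iterations and that of the current iteration;
  it either queries one more interval in the current iteration (\<open>Some i\<close>) or ends the
  current iteration (\<open>None\<close>).
\<close>

type_synonym transcript = "(nat \<times> real) list"
type_synonym algorithm = "transcript list \<Rightarrow> transcript \<Rightarrow> nat option"

definition queried :: "transcript \<Rightarrow> nat set" where
  "queried t = fst ` set t"

definition iterative_algorithm :: "minset \<Rightarrow> algorithm \<Rightarrow> bool" where
  "iterative_algorithm P \<pi> \<longleftrightarrow>
     (\<forall>h t i. \<pi> h t = Some i \<longrightarrow> i \<in> indices P - queried (concat h @ t))"

text \<open>
  The numeral argument bounds the number of further queries. Starting it with the number of
  intervals is no restriction, because no interval is queried twice.
\<close>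

fun run_iteration ::
    "algorithm \<Rightarrow> (nat \<Rightarrow> real) \<Rightarrow> transcript list \<Rightarrow> nat \<Rightarrow> transcript \<Rightarrow> transcript" where
  "run_iteration \<pi> w h 0 t = t"
| "run_iteration \<pi> w h (Suc k) t =
     (case \<pi> h t of None \<Rightarrow> t | Some i \<Rightarrow> run_iteration \<pi> w h k (t @ [(i, w i)]))"

text \<open>
  Transcripts of the executed iterations among the first \<open>j\<close> ones. Iterations are counted from
  \<open>0\<close>: the sets \<open>G\<^sub>1, G\<^sub>2, \<dots>\<close> are \<open>query_set P \<pi> w 0, query_set P \<pi> w 1, \<dots>\<close>.
\<close>

primrec history :: "minset \<Rightarrow> algorithm \<Rightarrow> (nat \<Rightarrow> real) \<Rightarrow> nat \<Rightarrow> transcript list" where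
  "history P \<pi> w 0 = []"
| "history P \<pi> w (Suc j) =
     (let h = history P \<pi> w j in
      if feasible P w (queried (concat h)) then h
      else h @ [run_iteration \<pi> w h (num_intervals P) []])"

definition queried_before :: "minset \<Rightarrow> algorithm \<Rightarrow> (nat \<Rightarrow> real) \<Rightarrow> nat \<Rightarrow> nat set" where
  "queried_before P \<pi> w j = queried (concat (history P \<pi> w j))"

definition executed :: "minset \<Rightarrow> algorithm \<Rightarrow> (nat \<Rightarrow> real) \<Rightarrow> nat \<Rightarrow> bool" where
  "executed P \<pi> w j \<longleftrightarrow> \<not> feasible P w (queried_before P \<pi> w j)"

definition query_set :: "minset \<Rightarrow> algorithm \<Rightarrow> (nat \<Rightarrow> real) \<Rightarrow> nat \<Rightarrow> nat set" where
  "query_set P \<pi> w j =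
     (if executed P \<pi> w j
      then queried (run_iteration \<pi> w (history P \<pi> w j) (num_intervals P) []) else {})"

definition ALG :: "minset \<Rightarrow> algorithm \<Rightarrow> (nat \<Rightarrow> real) \<Rightarrow> nat" where
  "ALG P \<pi> w = card (\<Union>j. query_set P \<pi> w j)"


section \<open>Random values and greedy algorithms\<close>

definition value_distributions :: "minset \<Rightarrow> (nat \<Rightarrow> real measure) \<Rightarrow> bool" where
  "value_distributions P D \<longleftrightarrow>
     (\<forall>i\<in>indices P. prob_space (D i) \<and> sets (D i) = sets (restrict_space borel (interval P i)))"

text \<open>The joint law of the independent values; its space is \<open>realizations P\<close>.\<close>

definition value_law :: "minset \<Rightarrow> (nat \<Rightarrow> real measure) \<Rightarrow> (nat \<Rightarrow> real) measure" where
  "value_law P D = PiM (indices P) D"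

text \<open>Elementary conditional expectation; it is \<open>0\<close> if the event has probability \<open>0\<close>.\<close>

definition expectation_given :: "'a measure \<Rightarrow> ('a \<Rightarrow> real) \<Rightarrow> ('a \<Rightarrow> bool) \<Rightarrow> real" where
  "expectation_given M X Y =
     (\<integral>\<omega>. X \<omega> * of_bool (Y \<omega>) \<partial>M) / measure M {\<omega> \<in> space M. Y \<omega>}"

text \<open>
  The first condition makes the sets \<open>G\<^sub>j\<close> random variables, so that the expectations
  below are meaningful.
\<close>

definition greedy_algorithm ::
    "real \<Rightarrow> real \<Rightarrow> real \<Rightarrow> minset \<Rightarrow> (nat \<Rightarrow> real measure) \<Rightarrow> algorithm \<Rightarrow> bool" where
  "greedy_algorithm \<alpha> \<beta> \<gamma> P D \<pi> \<longleftrightarrow>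
     iterative_algorithm P \<pi> \<and>
     (\<forall>j. (\<lambda>w. query_set P \<pi> w j) \<in> value_law P D \<rightarrow>\<^sub>M count_space UNIV) \<and>
     (\<forall>w\<in>realizations P. \<forall>j. executed P \<pi> w j \<longrightarrow>
        approximates_greedy \<alpha> \<gamma> P w (queried_before P \<pi> w j) (query_set P \<pi> w j)) \<and>
     (\<forall>j. measure (value_law P D) {w \<in> space (value_law P D). executed P \<pi> w j} > 0 \<longrightarrow>
        expectation_given (value_law P D) (\<lambda>w. real (card (query_set P \<pi> w j)))
          (\<lambda>w. executed P \<pi> w j) \<le> \<beta>)"

definition rho_bar :: "real \<Rightarrow> nat \<Rightarrow> real \<Rightarrow> int" where
  "rho_bar \<gamma> m d = \<lceil>ln (\<gamma> * real m * d)\<rceil> + \<lceil>ln (real m)\<rceil>"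

end

theory Submission
  imports Defs
begin

text \<open>
  Since \<open>E[X\<^sub>j] \<le> \<beta> \<cdot> Pr[Y\<^sub>j = 1]\<close> for every \<open>j\<close>, it suffices to bound for each realization the number of
  iterations by \<open>k \<cdot> \<rho>\<close>, where \<open>k = \<alpha> \<cdot> OPT\<close>. An iteration shrinks either the number \<open>A \<le> m\<close> of unsatisfied
  constraints or the total residual \<open>b' < B\<close>, with \<open>B\<close> the argument of the first logarithm, by the
  factor \<open>1 - 1/k\<close>, and before such an iteration the shrinking quantity is at least \<open>1\<close>.

  The usual estimate \<open>1 - 1/k \<le> exp (-1/k)\<close> only gives at most \<open>k ln m + 1\<close> and \<open>k ln B + 1\<close> iterations of the
  two kinds, and as \<open>k\<close> need not be an integer the two extra iterations are not absorbed by the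
  ceilings. The sharper \<open>- ln (1 - 1/k) \<ge> 1 / (k - 1/2)\<close> replaces \<open>k\<close> by \<open>k - 1/2\<close>, which suffices when
  \<open>\<rho> \<ge> 4\<close>. For smaller \<open>\<rho>\<close> and \<open>m \<ge> 2\<close> we have \<open>m \<le> 7\<close> unless there are no iterations of the
  second kind, and the integrality of \<open>A\<close> saves the missing fraction. For \<open>m = 1\<close> every iteration
  queries some \<open>i\<close> with \<open>a\<^sub>i > 0\<close> in the only set, and every feasible set contains all of these.
\<close>

section \<open>Lengths of decreasing chains\<close>

text \<open>With \<open>x = 1 / k\<close> the left-hand side is \<open>4 / (2 - x) - 2\<close>, so
  the claim is \<open>f 0 \<le> f x\<close> for the \<open>f\<close> in the proof, where
  \<open>f 0 = -2\<close>. Its derivative is nonnegative because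
  \<open>(2 - x) * (2 - x) - 4 * (1 - x) = x * x\<close>.\<close>

lemma inverse_le_ln_ratio:
  fixes k :: real
  assumes "k > 1"
  shows "1 / (k - 1 / 2) \<le> - ln (1 - 1 / k)"
proof -
  define f where "f x = - ln (1 - x) - 4 / (2 - x)" for x :: real
  have "f 0 \<le> f (1 / k)"
  proof (rule DERIV_nonneg_imp_nondecreasing[of 0 "1 / k" f])
    show "0 \<le> 1 / k" using assms by simp
    fix x :: real assume x: "0 \<le> x" "x \<le> 1 / k"
    have "1 / k < 1" using assms by simp
    then have x1: "x < 1" using x by linarith
    have "(f has_real_derivative (1 / (1 - x) - 4 / ((2 - x) * (2 - x)))) (at x)"
      unfolding f_def using x1 by (auto intro!: derivative_eq_intros)
    moreover have "1 / (1 - x) - 4 / ((2 - x) * (2 - x)) \<ge> 0"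
    proof -
      have "4 * (1 - x) \<le> (2 - x) * (2 - x)"
        using zero_le_square[of x] by (simp add: algebra_simps)
      then have "4 / ((2 - x) * (2 - x)) \<le> 1 / (1 - x)"
        using x1 by (subst frac_le_eq) (auto simp: divide_nonpos_pos)
      then show ?thesis by simp
    qed
    ultimately show "\<exists>y. DERIV f x :> y \<and> 0 \<le> y" by blast
  qed
  moreover have "4 / (2 - 1 / k) - 2 = 1 / (k - 1 / 2)"
    using assms by (simp add: divide_simps)
  ultimately show ?thesis by (simp add: f_def)
qed

text \<open>The \<open>t\<close> terms are linked by \<open>t - 1\<close> contractions, so
  \<open>1 \<le> c (t - 1) \<le> (1 - 1 / k) ^ (t - 1) * B\<close>; taking logarithms bounds
  \<open>t - 1\<close>. The summand 1 remains because the step out of the last term may end below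
  1.\<close>

lemma geometric_chain_length:
  fixes c :: "nat \<Rightarrow> real" and k B :: real
  assumes k: "k \<ge> 1" and t: "t > 0"
    and start: "c 0 \<le> B"
    and ge1: "\<And>i. i < t \<Longrightarrow> c i \<ge> 1"
    and step: "\<And>i. Suc i < t \<Longrightarrow> c (Suc i) \<le> (1 - 1 / k) * c i"
  shows "real t \<le> 1 + (k - 1 / 2) * ln B"
proof -
  define r where "r = 1 - 1 / k"
  have r: "0 \<le> r" "r < 1" using k by (auto simp: r_def)
  have pow: "i < t \<Longrightarrow> c i \<le> r ^ i * B" for i
  proof (induction i)
    case 0 then show ?case using start by simp
  next
    case (Suc i)
    have "c (Suc i) \<le> r * c i" using step Suc.prems by (simp add: r_def)
    also have "\<dots> \<le> r * (r ^ i * B)" using Suc r by (intro mult_left_mono) auto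
    finally show ?case by simp
  qed
  have B: "B \<ge> 1" using ge1[OF t] start by simp
  show "real t \<le> 1 + (k - 1 / 2) * ln B"
  \<comment> \<open>For \<open>t = 1\<close> also \<open>k = 1\<close> can occur, where
    \<open>r = 0\<close>; longer chains force \<open>k > 1\<close>, so that \<open>ln r\<close> can
    be used.\<close>
  proof (cases "t = 1")
    case True then show ?thesis using k B by simp
  next
    case False
    define s where "s = t - 1"
    have s: "s > 0" "real t = 1 + real s" using False t by (auto simp: s_def)
    have le: "1 \<le> r ^ s * B" using pow[of s] ge1[of s] t by (force simp: s_def)
    have "k \<noteq> 1" using le s by (auto simp: r_def zero_power)
    then have k1: "k > 1" using k by simp
    then have r0: "r > 0" by (simp add: r_def)
    have "0 \<le> ln (r ^ s * B)" using le by simp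
    also have "\<dots> = real s * ln r + ln B" using r0 B by (simp add: ln_mult ln_realpow)
    finally have "real s * (- ln r) \<le> ln B" by simp
    moreover have "real s * (1 / (k - 1 / 2)) \<le> real s * (- ln r)"
      using inverse_le_ln_ratio[OF k1] by (intro mult_left_mono) (auto simp: r_def)
    ultimately have "real s / (k - 1 / 2) \<le> ln B" by simp
    then show ?thesis using k1 s by (simp add: field_simps)
  qed
qed

text \<open>The start value 7 is the integer part of \<open>exp 2\<close>, for the case \<lceil>ln
  m\<rceil> = 2. If \<open>4 * k < 2 * t + 1\<close>, each step loses more than the fraction
  \<open>4 / (2 * t + 1)\<close>, and rounding to integers pushes \<open>c 0\<close> beyond 7. The
  chain 7, 1 with \<open>k = 7 / 6\<close> violates the bound, which is why \<open>t = 2\<close> is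
  excluded.\<close>

lemma nat_chain_length_le_seven:
  fixes c :: "nat \<Rightarrow> nat" and k :: real
  assumes k: "k \<ge> 1" and t: "t \<ge> 3"
    and start: "c 0 \<le> 7"
    and ge1: "\<And>i. i < t \<Longrightarrow> c i \<ge> 1"
    and step: "\<And>i. Suc i < t \<Longrightarrow> real (c (Suc i)) \<le> (1 - 1 / k) * real (c i)"
  shows "real t \<le> 2 * k - 1 / 2"
proof (rule ccontr)
  assume neg: "\<not> ?thesis"
  have gap: "k * (real (c i) - real (c (Suc i))) \<ge> real (c i)" if "Suc i < t" for i
    using step[OF that] k by (simp add: field_simps)
  have dec: "c (Suc i) < c i" if "Suc i < t" for i
  proof -
    have "c i \<ge> 1" using ge1 that by simp
    then have "k * (real (c i) - real (c (Suc i))) > 0" using gap[OF that] by linarith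
    then show ?thesis using k by (simp add: zero_less_mult_iff)
  qed
  \<comment> \<open>Negating the claim means \<open>4 * k < 2 * t + 1\<close>; the summand 1
    expresses the strict inequality between integers.\<close>
  have lin: "4 * c i + 1 + (2 * t + 1) * c (Suc i) \<le> (2 * t + 1) * c i" if "Suc i < t" for i
  proof -
    have "4 * real (c i) \<le> (4 * k) * (real (c i) - real (c (Suc i)))" using gap[OF that] by simp
    also have "\<dots> < (2 * real t + 1) * (real (c i) - real (c (Suc i)))"
      using neg dec[OF that] by (intro mult_strict_right_mono) auto
    finally have "real (4 * c i + (2 * t + 1) * c (Suc i)) < real ((2 * t + 1) * c i)"
      by (simp add: algebra_simps)
    then show ?thesis by linarith
  qed
  \<comment> \<open>If the claim failed, \<open>c\<close> would grow backwards from \<open>1\<close> past \<open>7\<close>: the numbers in the case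
    distinction below are the resulting lower bounds, rounded up.\<close>
  have lower_step: "c i \<ge> y"
    if "c j \<ge> x" "Suc i = j" "j < t" "(2 * t - 3) * (y - 1) \<le> (2 * t + 1) * x" for i j x y
  proof (rule ccontr)
    assume "\<not> c i \<ge> y"
    then have "(2 * t - 3) * c i \<le> (2 * t - 3) * (y - 1)" by (intro mult_left_mono) auto
    also have "\<dots> \<le> (2 * t + 1) * x" by (fact that(4))
    also have "\<dots> \<le> (2 * t + 1) * c j" using that(1) by (intro mult_left_mono) auto
    finally have "(2 * t - 3) * c i + 4 * c i \<le> (2 * t + 1) * c j + 4 * c i" by simp
    moreover have "(2 * t - 3) * c i + 4 * c i = (2 * t + 1) * c i"
    proof -
      have "2 * t - 3 + 4 = 2 * t + 1" using t by simp
      then show ?thesis by (metis add_mult_distrib)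
    qed
    ultimately show False using lin[of i] that(2,3) by simp
  qed
  \<comment> \<open>Strict descent costs at least 1 per step, which leaves only the lengths 3 to
    7.\<close>
  have bound: "i < t \<Longrightarrow> c i + i \<le> 7" for i
  proof (induction i)
    case 0 then show ?case using start by simp
  next
    case (Suc i) then show ?case using dec[of i] by simp
  qed
  have "t \<le> 7" using bound[of "t - 1"] ge1[of "t - 1"] t by linarith
  with t consider "t = 3" | "t = 4" | "t = 5" | "t = 6" | "t = 7" by linarith
  then show False
  proof cases
    case 1
    have "c 2 \<ge> 1" using ge1 1 by simp
    then have "c 1 \<ge> 3" by (rule lower_step) (simp_all add: 1)
    then have "c 0 \<ge> 8" by (rule lower_step) (simp_all add: 1)
    then show False using start by simp
  next
    case 2
    have "c 3 \<ge> 1" using ge1 2 by simp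
    then have "c 2 \<ge> 2" by (rule lower_step) (simp_all add: 2)
    then have "c 1 \<ge> 4" by (rule lower_step) (simp_all add: 2)
    then have "c 0 \<ge> 8" by (rule lower_step) (simp_all add: 2)
    then show False using start by simp
  next
    case 3
    have "c 4 \<ge> 1" using ge1 3 by simp
    then have "c 3 \<ge> 2" by (rule lower_step) (simp_all add: 3)
    then have "c 2 \<ge> 4" by (rule lower_step) (simp_all add: 3)
    then have "c 1 \<ge> 7" by (rule lower_step) (simp_all add: 3)
    then have "c 0 \<ge> 12" by (rule lower_step) (simp_all add: 3)
    then show False using start by simp
  next
    case 4
    have "c 5 \<ge> 1" using ge1 4 by simp
    then have "c 4 \<ge> 2" by (rule lower_step) (simp_all add: 4)
    then have "c 3 \<ge> 3" by (rule lower_step) (simp_all add: 4)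
    then have "c 2 \<ge> 5" by (rule lower_step) (simp_all add: 4)
    then have "c 1 \<ge> 8" by (rule lower_step) (simp_all add: 4)
    then have "c 0 \<ge> 12" by (rule lower_step) (simp_all add: 4)
    then show False using start by simp
  next
    case 5
    have "c 6 \<ge> 1" using ge1 5 by simp
    then have "c 5 \<ge> 2" by (rule lower_step) (simp_all add: 5)
    then have "c 4 \<ge> 3" by (rule lower_step) (simp_all add: 5)
    then have "c 3 \<ge> 5" by (rule lower_step) (simp_all add: 5)
    then have "c 2 \<ge> 7" by (rule lower_step) (simp_all add: 5)
    then have "c 1 \<ge> 10" by (rule lower_step) (simp_all add: 5)
    then have "c 0 \<ge> 14" by (rule lower_step) (simp_all add: 5)
    then show False using start by simp
  qed
qed

text \<open>Contractions of one kind are interleaved with iterations of the other kind. With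
  \<open>J\<close> listed in increasing order, \<open>f\<close> has been contracted right after
  \<open>e i\<close> and cannot grow before \<open>e (Suc i)\<close>, so the values at
  \<open>J\<close> alone form a contracting chain.\<close>

lemma antimono_subsequence:
  fixes f :: "nat \<Rightarrow> real"
  assumes "antimono f" and J: "finite J"
    and step: "\<And>j. j \<in> J \<Longrightarrow> f (Suc j) \<le> r * f j"
  obtains e where "\<And>i. i < card J \<Longrightarrow> e i \<in> J"
    and "\<And>i. Suc i < card J \<Longrightarrow> f (e (Suc i)) \<le> r * f (e i)"
proof
  let ?l = "sorted_list_of_set J"
  show mem: "?l ! i \<in> J" if "i < card J" for i
    using that J by (metis length_sorted_list_of_set nth_mem set_sorted_list_of_set)
  show "f (?l ! Suc i) \<le> r * f (?l ! i)" if "Suc i < card J" for i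
  proof -
    have "?l ! i < ?l ! Suc i"
      using that strict_sorted_list_of_set[of J] by (simp add: sorted_wrt_nth_less)
    then have "f (?l ! Suc i) \<le> f (Suc (?l ! i))" using assms(1) by (simp add: antimono_def)
    also have "\<dots> \<le> r * f (?l ! i)" using step mem that by simp
    finally show ?thesis .
  qed
qed

text \<open>Splitting the iterations by kind gives chains of lengths at most
  \<open>1 + (k - 1 / 2) * L1\<close> and \<open>1 + (k - 1 / 2) * L2\<close>. These add up to at
  most \<open>k * (L1 + L2)\<close> once \<open>L1 + L2 \<ge> 4\<close>; smaller sums are settled by
  cases, using that the lengths and the values of \<open>a\<close> are integers.\<close>

lemma greedy_chain_length:
  fixes a :: "nat \<Rightarrow> nat" and b :: "nat \<Rightarrow> real" and k B :: real and m T :: nat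
  assumes k: "k \<ge> 1" and m: "m \<ge> 2"
    and a: "antimono a" "a 0 \<le> m" "\<And>j. j < T \<Longrightarrow> a j \<ge> 1"
    and b: "antimono b" "b 0 < B"
    and step: "\<And>j. j < T \<Longrightarrow> real (a (Suc j)) \<le> (1 - 1 / k) * real (a j) \<or>
                 b j \<ge> 1 \<and> b (Suc j) \<le> (1 - 1 / k) * b j"
    and L: "\<lceil>ln B\<rceil> \<ge> 0"
  shows "real T \<le> k * real_of_int (\<lceil>ln B\<rceil> + \<lceil>ln (real m)\<rceil>)"
proof -
  \<comment> \<open>An iteration of both kinds is counted in \<open>J1\<close> only, so that
    \<open>J1\<close> and \<open>J2\<close> partition the iterations.\<close>
  define J1 where "J1 = {j. j < T \<and> real (a (Suc j)) \<le> (1 - 1 / k) * real (a j)}"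
  define J2 where "J2 = {..<T} - J1"
  have fin: "finite J1" "finite J2" by (auto simp: J1_def J2_def)
  have T: "T = card J1 + card J2"
  proof -
    have "{..<T} = J1 \<union> J2" "J1 \<inter> J2 = {}" by (auto simp: J1_def J2_def)
    then show ?thesis using fin by (metis card_Un_disjoint card_lessThan)
  qed
  define L1 where "L1 = \<lceil>ln (real m)\<rceil>"
  define L2 where "L2 = \<lceil>ln B\<rceil>"
  define t1 where "t1 = card J1"
  define t2 where "t2 = card J2"
  have anti: "antimono (\<lambda>j. real (a j))" using a(1) by (simp add: antimono_def)
  have J1_step: "real (a (Suc j)) \<le> (1 - 1 / k) * real (a j)" if "j \<in> J1" for j
    using that by (simp add: J1_def)
  have J2_step: "b j \<ge> 1 \<and> b (Suc j) \<le> (1 - 1 / k) * b j" if "j \<in> J2" for j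
    using that step[of j] by (auto simp: J1_def J2_def)
  obtain e where e: "\<And>i. i < t1 \<Longrightarrow> e i \<in> J1"
      "\<And>i. Suc i < t1 \<Longrightarrow> real (a (e (Suc i))) \<le> (1 - 1 / k) * real (a (e i))"
    using antimono_subsequence[OF anti fin(1) J1_step] unfolding t1_def by metis
  obtain e' where e': "\<And>i. i < t2 \<Longrightarrow> e' i \<in> J2"
      "\<And>i. Suc i < t2 \<Longrightarrow> b (e' (Suc i)) \<le> (1 - 1 / k) * b (e' i)"
    using antimono_subsequence[OF b(1) fin(2) conjunct2[OF J2_step]] unfolding t2_def by metis
  have e_ge: "a (e i) \<ge> 1" if "i < t1" for i using e(1)[OF that] a(3) by (auto simp: J1_def)
  have e'_ge: "b (e' i) \<ge> 1" if "i < t2" for i using J2_step e'(1)[OF that] by simp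
  have e_start: "a (e 0) \<le> m" using a(1,2) by (metis antimonoD le_trans zero_le)
  have e'_start: "b (e' 0) < B" using b by (metis antimonoD le_less_trans zero_le)

  have L1: "ln (real m) \<le> L1" and L2: "ln B \<le> L2" by (simp_all add: L1_def L2_def)
  have "ln (real m) > 0" using m by simp
  then have L1pos: "L1 \<ge> 1" by (simp add: L1_def)
  have L2nn: "L2 \<ge> 0" using L by (simp add: L2_def)
  have t1_le: "real t1 \<le> 1 + (k - 1 / 2) * L1"
  proof (cases "t1 = 0")
    case True then show ?thesis using k L1pos by simp
  next
    case False
    have "real t1 \<le> 1 + (k - 1 / 2) * ln (real m)"
      using geometric_chain_length[of k t1 "\<lambda>i. real (a (e i))" "real m"]
        k False e e_ge e_start by fastforce
    also have "\<dots> \<le> 1 + (k - 1 / 2) * L1" using k L1 by (intro add_left_mono mult_left_mono) auto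
    finally show ?thesis .
  qed
  have t2_le: "real t2 \<le> 1 + (k - 1 / 2) * L2"
  proof (cases "t2 = 0")
    case True then show ?thesis using k L2nn by simp
  next
    case False
    have "real t2 \<le> 1 + (k - 1 / 2) * ln B"
      using geometric_chain_length[of k t2 "\<lambda>i. b (e' i)" B] k False e' e'_ge e'_start
      by fastforce
    also have "\<dots> \<le> 1 + (k - 1 / 2) * L2" using k L2 by (intro add_left_mono mult_left_mono) auto
    finally show ?thesis .
  qed
  \<comment> \<open>The strictness of \<open>b 0 < B\<close> enters here: \<open>b 0 = B = 1\<close>
    would give \<open>L2 = 0\<close> but allow an iteration of the second kind.\<close>
  have t2_zero: "t2 = 0" if "L2 = 0"
  proof (rule ccontr)
    assume "t2 \<noteq> 0"
    then have "B > 1" using e'_ge[of 0] e'_start by simp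
    then have "ln B > 0" by simp
    then show False using L2 that by simp
  qed
  have "real t1 + real t2 \<le> k * (real_of_int L2 + real_of_int L1)"
  proof -
    consider "L1 \<ge> 3" | "L1 = 2" | "L1 = 1" using L1pos by linarith
    then show ?thesis
    proof cases
      case 1
      show ?thesis
      proof (cases "L2 = 0")
        case True
        then show ?thesis using t2_zero t1_le 1 by (simp add: algebra_simps)
      next
        case False
        then have "L2 \<ge> 1" using L2nn by simp
        then show ?thesis using t1_le t2_le 1 by (simp add: algebra_simps)
      qed
    next
      case 2
      have "exp (ln (real m)) \<le> exp 2" using L1 2 by (subst exp_le_cancel_iff) simp
      then have "real m \<le> exp 2" using m by simp
      also have "exp (2::real) = exp 1 * exp 1" by (simp flip: exp_add)
      also have "\<dots> < 2.72 * 2.72" using e_less_272 by (intro mult_strict_mono) auto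
      finally have m7: "m \<le> 7" by simp
      \<comment> \<open>For \<open>t1 \<ge> 3\<close> integrality saves 1/2 on \<open>t1\<close>,
        which pays for an excess of at most 1/2 in \<open>t2\<close>. For \<open>t1 \<le> 2\<close>
        one has \<open>t1 \<le> 2 * k\<close>, and only \<open>L2 = 1\<close> leaves an
        excess.\<close>
      consider "L2 = 0" | "L2 \<ge> 1" "t1 \<ge> 3" | "L2 \<ge> 2" "t1 \<le> 2" | "L2 = 1" "t1 \<le> 2"
        using L2nn by linarith
      then show ?thesis
      proof cases
        case 1
        then show ?thesis using t2_zero t1_le 2 by (simp add: algebra_simps)
      next
        case A: 2
        have "real t1 \<le> 2 * k - 1 / 2"
          using nat_chain_length_le_seven[of k t1 "\<lambda>i. a (e i)"] k A e e_ge e_start m7 by force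
        then show ?thesis using t2_le 2 A by (simp add: algebra_simps)
      next
        case 3
        then show ?thesis using t2_le 2 k by (simp add: algebra_simps)
      next
        case 4
        show ?thesis
        \<comment> \<open>From \<open>5 / 4\<close> on, \<open>2 + (k + 1 / 2) \<le> 3 * k\<close>;
          below it, \<open>t2 \<le> k + 1 / 2 < 2\<close> forces \<open>t2 \<le> 1\<close>.\<close>
        proof (cases "k \<ge> 5 / 4")
          case True
          then show ?thesis using t2_le 2 4 by (simp add: algebra_simps)
        next
          case False
          then have "t2 \<le> 1" using t2_le 4 by simp
          then show ?thesis using k 4 2 by simp
        qed
      qed
    next
      case 3
      have "exp (ln (real m)) \<le> exp 1" using L1 3 by (subst exp_le_cancel_iff) simp
      then have m2: "m = 2" using e_less_272 m by simp
      \<comment> \<open>With \<open>m = 2\<close> the longest possible chain of values of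
        \<open>a\<close> is 2, 1, and halving in one step requires \<open>k \<ge> 2\<close>.\<close>
      have two: "k \<ge> 2" "t1 \<le> 2" if "t1 \<ge> 2"
      proof -
        have s: "real (a (e 1)) \<le> (1 - 1 / k) * real (a (e 0))" using e(2)[of 0] that by simp
        have g: "a (e 1) \<ge> 1" "a (e 0) \<le> 2" using e_ge[of 1] e_start m2 that by auto
        have "1 \<le> (1 - 1 / k) * real (a (e 0))" using s g by simp
        also have "\<dots> \<le> (1 - 1 / k) * 2" using g k by (intro mult_left_mono) auto
        finally show "k \<ge> 2" using k by (simp add: field_simps)
        show "t1 \<le> 2"
        proof (rule ccontr)
          assume "\<not> t1 \<le> 2"
          then have s': "real (a (e 2)) \<le> (1 - 1 / k) * real (a (e 1))" "a (e 2) \<ge> 1"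
            using e(2)[of 1] e_ge[of 2] by (auto simp: numeral_2_eq_2)
          have lt: "(1 - 1 / k) * x < x" if "x > 0" for x :: real using k that by (simp add: algebra_simps)
          have "real (a (e 2)) < real (a (e 1))" using s'(1) lt[of "real (a (e 1))"] g(1) by linarith
          moreover have "real (a (e 1)) < real (a (e 0))"
          proof (rule le_less_trans[OF s lt])
            show "real (a (e 0)) > 0" using s g(1) by (cases "a (e 0) = 0") auto
          qed
          ultimately show False using s' g by simp
        qed
      qed
      consider "L2 = 0" | "L2 = 1" | "L2 \<ge> 2" using L2nn by linarith
      then show ?thesis
      proof cases
        case 1
        then show ?thesis using t2_zero two 3 k by (cases "t1 \<ge> 2") auto
      next
        case 2
        have t2k: "real t2 \<le> k + 1 / 2" using t2_le 2 by simp
        have "real t1 + real t2 \<le> 2 * k"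
        proof (cases "t1 \<ge> 2")
          case True
          show ?thesis
          \<comment> \<open>This is the threshold for \<open>2 + (k + 1 / 2) \<le> 2 * k\<close>;
            below it \<open>t2 < 3\<close>. For \<open>t1 \<le> 1\<close> the analogous threshold is
            \<open>3 / 2\<close>.\<close>
          proof (cases "k \<ge> 5 / 2")
            case True
            then show ?thesis using two \<open>t1 \<ge> 2\<close> t2k by simp
          next
            case False
            then have "t2 \<le> 2" using t2k by simp
            then show ?thesis using two[OF \<open>t1 \<ge> 2\<close>] by simp
          qed
        next
          case False
          show ?thesis
          proof (cases "k \<ge> 3 / 2")
            case True
            then show ?thesis using False t2k by simp
          next
            case F: False
            then have "t2 \<le> 1" using t2k by simp
            then show ?thesis using False k by simp
          qed
        qed
        then show ?thesis using 2 3 by simp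
      next
        case A: 3
        then show ?thesis using t2_le two 3 k by (cases "t1 \<ge> 2") (auto simp: algebra_simps)
      qed
    qed
  qed
  then show ?thesis using T by (simp add: t1_def t2_def L1_def L2_def)
qed

section \<open>Iterations for a fixed realization\<close>

lemma minset_instance_finite_family:
  assumes "minset_instance P"
  shows "finite (family P)"
proof (rule finite_subset)
  show "family P \<subseteq> Pow (indices P)" using assms by (simp add: minset_instance_def)
qed (simp add: indices_def)

section \<open>Feasible sets, optimum and residuals of one realization\<close>

locale minset_realization =
  fixes P :: minset and w :: "nat \<Rightarrow> real"
  assumes inst: "minset_instance P" and realization: "w \<in> realizations P"
begin

lemma finite_indices [simp]: "finite (indices P)"
  by (simp add: indices_def)

lemma finite_family [simp]: "finite (family P)"
  using inst by (rule minset_instance_finite_family)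

lemma family_subset: "S \<in> family P \<Longrightarrow> S \<subseteq> indices P"
  using inst by (auto simp: minset_instance_def)

lemma finite_member: "S \<in> family P \<Longrightarrow> finite S"
  using family_subset finite_indices finite_subset by blast

lemma value_in_interval: "i \<in> indices P \<Longrightarrow> w i \<in> interval P i"
  using realization by (auto simp: realizations_def)

lemma value_bounds:
  assumes "i \<in> indices P"
  shows "lower P i \<le> w i" "w i \<le> upper P i"
  using value_in_interval[OF assms] by (auto simp: interval_def split: if_splits)

lemma coeff_a_nonneg: "i \<in> indices P \<Longrightarrow> 0 \<le> coeff_a P w i"
  using value_bounds by (simp add: coeff_a_def)

lemma min_value_le: "S \<in> family P \<Longrightarrow> min_value P w \<le> (\<Sum>i\<in>S. w i)"
  unfolding min_value_def by (intro Min_le) auto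

lemma sum_coeff_a: "(\<Sum>i\<in>S. coeff_a P w i) = (\<Sum>i\<in>S. w i) - set_lower P S"
  by (simp add: coeff_a_def set_lower_def sum_subtractf)

lemma feasible_indices: "feasible P w (indices P)"
  unfolding feasible_def
proof (intro conjI ballI)
  fix S assume S: "S \<in> family P"
  then have "S \<inter> indices P = S" using family_subset by blast
  then show "(\<Sum>i\<in>S \<inter> indices P. coeff_a P w i) \<ge> coeff_b P w S"
    using min_value_le[OF S] by (simp add: sum_coeff_a coeff_b_def)
qed simp

lemma feasible_subset_indices: "feasible P w Q \<Longrightarrow> Q \<subseteq> indices P"
  by (simp add: feasible_def)

lemma finite_feasible_cards: "finite {card Q | Q. feasible P w Q}"
  by (rule finite_subset[of _ "card ` Pow (indices P)"]) (auto simp: feasible_def)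

lemma OPT_attained:
  obtains Q where "feasible P w Q" "card Q = OPT P w"
proof -
  have "{card Q | Q. feasible P w Q} \<noteq> {}" using feasible_indices by blast
  then have "OPT P w \<in> {card Q | Q. feasible P w Q}"
    unfolding OPT_def by (rule Min_in[OF finite_feasible_cards])
  then show ?thesis using that by auto
qed

lemma OPT_le: "feasible P w Q \<Longrightarrow> OPT P w \<le> card Q"
  unfolding OPT_def by (rule Min_le[OF finite_feasible_cards]) auto

lemma OPT_le_num_intervals: "OPT P w \<le> num_intervals P"
  using OPT_le[OF feasible_indices] by (simp add: indices_def)

text \<open>In this form, with a quantifier over a finite set, measurability of \<open>OPT\<close>
  reduces to that of \<open>feasible\<close> for a fixed set.\<close>

lemma OPT_eq_Least:
  "OPT P w = (LEAST c. \<exists>Q\<in>Pow (indices P). card Q = c \<and> feasible P w Q)"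
proof (rule sym, rule Least_equality)
  show "\<exists>Q\<in>Pow (indices P). card Q = OPT P w \<and> feasible P w Q"
    using OPT_attained feasible_subset_indices by (metis PowI)
qed (use OPT_le in blast)

lemma OPT_pos:
  assumes "\<not> feasible P w {}"
  shows "OPT P w \<ge> 1"
proof (rule ccontr)
  assume "\<not> OPT P w \<ge> 1"
  then have "OPT P w = 0" by simp
  moreover obtain Q where Q: "feasible P w Q" "card Q = OPT P w" by (rule OPT_attained)
  moreover have "finite Q" using Q(1) feasible_subset_indices finite_indices finite_subset by blast
  ultimately have "Q = {}" by simp
  then show False using assms Q by simp
qed

lemma residual_antimono:
  assumes "\<gamma> \<ge> 0" "S \<in> family P" "Q \<subseteq> Q'"
  shows "residual \<gamma> P w Q' S \<le> residual \<gamma> P w Q S"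
proof -
  have "(\<Sum>i\<in>Q \<inter> S. \<gamma> * coeff_a P w i) \<le> (\<Sum>i\<in>Q' \<inter> S. \<gamma> * coeff_a P w i)"
    using assms finite_member[OF assms(2)] family_subset[OF assms(2)] coeff_a_nonneg
    by (intro sum_mono2) auto
  then show ?thesis by (auto simp: residual_def)
qed

lemma total_residual_antimono:
  assumes "\<gamma> \<ge> 0" "Q \<subseteq> Q'"
  shows "total_residual \<gamma> P w Q' \<le> total_residual \<gamma> P w Q"
  unfolding total_residual_def using residual_antimono assms by (intro sum_mono) auto

lemma num_unsatisfied_antimono:
  assumes "\<gamma> \<ge> 0" "Q \<subseteq> Q'"
  shows "num_unsatisfied \<gamma> P w Q' \<le> num_unsatisfied \<gamma> P w Q"
proof -
  have "residual \<gamma> P w Q S > 0" if "S \<in> family P" "residual \<gamma> P w Q' S > 0" for S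
    using residual_antimono[OF assms(1) that(1) assms(2)] that(2) by linarith
  then show ?thesis unfolding num_unsatisfied_def by (intro card_mono) auto
qed

lemma num_unsatisfied_le: "num_unsatisfied \<gamma> P w Q \<le> card (family P)"
  unfolding num_unsatisfied_def by (intro card_mono) auto

lemma num_unsatisfied_pos:
  assumes "\<gamma> > 0" "Q \<subseteq> indices P" "\<not> feasible P w Q"
  shows "num_unsatisfied \<gamma> P w Q \<ge> 1"
proof -
  obtain S where S: "S \<in> family P" "(\<Sum>i\<in>S \<inter> Q. coeff_a P w i) < coeff_b P w S"
    using assms by (auto simp: feasible_def not_le)
  then have "(\<Sum>i\<in>Q \<inter> S. \<gamma> * coeff_a P w i) < \<gamma> * coeff_b P w S"
    using assms(1) by (simp add: Int_commute flip: sum_distrib_left)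
  then have "residual \<gamma> P w Q S > 0" by (simp add: residual_def)
  then have "{S \<in> family P. residual \<gamma> P w Q S > 0} \<noteq> {}" using S by blast
  then show ?thesis
    unfolding num_unsatisfied_def by (simp add: Suc_le_eq card_gt_0_iff)
qed

lemma max_gap_ge:
  assumes "S \<in> family P" "S' \<in> family P"
  shows "set_upper P S - set_lower P S' \<le> max_gap P"
  unfolding max_gap_def
proof (rule Max_ge)
  show "finite {set_upper P S - set_lower P S' | S S'. S \<in> family P \<and> S' \<in> family P}"
    by (rule finite_subset[of _ "(\<lambda>(S, S'). set_upper P S - set_lower P S') ` (family P \<times> family P)"])
       auto
qed (use assms in auto)

text \<open>Infeasibility of the empty set yields some \<open>S\<close> with L_S < w* \<le> w(S), so
  some interval in \<open>S\<close> is nontrivial. Being open, it has its value strictly below its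
  upper limit, hence w* < U_S and every b_S' is strictly less than the maximal gap.\<close>

lemma total_residual_empty_less:
  assumes "\<gamma> > 0" "\<not> feasible P w {}"
  shows "total_residual \<gamma> P w {} < \<gamma> * real (card (family P)) * max_gap P"
proof -
  obtain S where S: "S \<in> family P" "coeff_b P w S > 0"
    using assms(2) by (auto simp: feasible_def not_le)
  have le: "\<forall>i\<in>S. w i \<le> upper P i" using value_bounds family_subset[OF S(1)] by blast
  have "set_lower P S < (\<Sum>i\<in>S. w i)" using S min_value_le[OF S(1)] by (simp add: coeff_b_def)
  then have "\<not> (\<forall>i\<in>S. w i \<le> lower P i)" using sum_mono[of S w "lower P"] by (auto simp: set_lower_def)
  then obtain i where i: "i \<in> S" "lower P i < w i" by (auto simp: not_le)
  then have "w i < upper P i"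
    using value_in_interval[of i] family_subset[OF S(1)] by (auto simp: interval_def split: if_splits)
  then have "(\<Sum>i\<in>S. w i) < set_upper P S"
    unfolding set_upper_def using le i finite_member[OF S(1)] by (intro sum_strict_mono_ex1) auto
  then have lt: "min_value P w < set_upper P S" using min_value_le[OF S(1)] by simp
  have b: "coeff_b P w S' < max_gap P" if "S' \<in> family P" for S'
    using lt max_gap_ge[OF S(1) that] by (simp add: coeff_b_def)
  \<comment> \<open>Residuals are cut off at 0, so the strict bound on them also relies on a
    positive gap.\<close>
  have gap: "max_gap P > 0" using b[OF S(1)] S by simp
  have "total_residual \<gamma> P w {} < (\<Sum>S\<in>family P. \<gamma> * max_gap P)"
    unfolding total_residual_def
    using S(1) b gap assms(1) by (intro sum_strict_mono) (auto simp: residual_def)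
  then show ?thesis by (simp add: mult_ac)
qed

end

section \<open>Runs of a greedy algorithm on one realization\<close>

locale greedy_realization = minset_realization +
  fixes \<pi> :: algorithm and \<alpha> \<gamma> :: real
  assumes \<alpha>: "\<alpha> \<ge> 1" and \<gamma>: "\<gamma> > 0"
    and greedy: "\<And>j. executed P \<pi> w j \<Longrightarrow>
      approximates_greedy \<alpha> \<gamma> P w (queried_before P \<pi> w j) (query_set P \<pi> w j)"
begin

abbreviation "Q j \<equiv> queried_before P \<pi> w j"
abbreviation "G j \<equiv> query_set P \<pi> w j"
abbreviation "Y j \<equiv> executed P \<pi> w j"

lemma queried_before_0: "Q 0 = {}"
  by (simp add: queried_before_def queried_def)

lemma queried_before_Suc: "Q (Suc j) = Q j \<union> G j"
  by (auto simp: queried_before_def query_set_def executed_def queried_def Let_def)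

lemma executed_SucD: "Y (Suc j) \<Longrightarrow> Y j"
  by (auto simp: executed_def queried_before_def Let_def split: if_splits)

lemma executed_antimono: "i \<le> j \<Longrightarrow> Y j \<Longrightarrow> Y i"
  by (induction rule: dec_induct) (auto dest: executed_SucD)

lemma query_set_subset: "G j \<subseteq> indices P - Q j"
  using greedy[of j] by (cases "Y j") (auto simp: approximates_greedy_def query_set_def)

lemma queried_before_subset: "Q j \<subseteq> indices P"
  using query_set_subset by (induction j) (auto simp: queried_before_0 queried_before_Suc)

lemma executed_infeasible: "Y j \<Longrightarrow> \<not> feasible P w (Q j)"
  by (simp add: executed_def)

lemma executed_OPT_pos: "Y j \<Longrightarrow> OPT P w \<ge> 1"
  using executed_antimono[of 0 j] executed_infeasible[of 0] OPT_pos by (simp add: queried_before_0)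

text \<open>Querying only intervals with a_i = 0, or outside all sets of the family, changes neither
  A nor b', while both greedy alternatives demand a strict decrease of a positive quantity.\<close>

lemma executed_progress:
  assumes "Y j"
  shows "\<exists>S\<in>family P. \<exists>i\<in>S \<inter> G j. coeff_a P w i > 0"
proof (rule ccontr)
  assume neg: "\<not> ?thesis"
  have zero: "coeff_a P w i = 0" if i: "S \<in> family P" "i \<in> S" "i \<in> G j" for S i
  proof -
    have "\<not> coeff_a P w i > 0" using neg i by blast
    moreover have "coeff_a P w i \<ge> 0" using i coeff_a_nonneg family_subset by blast
    ultimately show ?thesis by simp
  qed
  have same: "residual \<gamma> P w (Q j \<union> G j) S = residual \<gamma> P w (Q j) S" if "S \<in> family P" for S
  proof -
    have "(\<Sum>i\<in>(Q j \<union> G j) \<inter> S. \<gamma> * coeff_a P w i) = (\<Sum>i\<in>Q j \<inter> S. \<gamma> * coeff_a P w i)"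
      using zero[OF that] finite_member[OF that] by (intro sum.mono_neutral_right) auto
    then show ?thesis by (simp add: residual_def)
  qed
  have "{S \<in> family P. residual \<gamma> P w (Q j \<union> G j) S > 0} = {S \<in> family P. residual \<gamma> P w (Q j) S > 0}"
    using same by auto
  then have A: "num_unsatisfied \<gamma> P w (Q j \<union> G j) = num_unsatisfied \<gamma> P w (Q j)"
    by (simp add: num_unsatisfied_def)
  have b: "total_residual \<gamma> P w (Q j \<union> G j) = total_residual \<gamma> P w (Q j)"
    using same by (simp add: total_residual_def)
  have "\<alpha> * real (OPT P w) > 0" using \<alpha> executed_OPT_pos[OF assms] by simp
  then have lt: "(1 - 1 / (\<alpha> * real (OPT P w))) * x < x" if "x > 0" for x :: real
    using that by (simp add: algebra_simps)
  have "num_unsatisfied \<gamma> P w (Q j) \<ge> 1"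
    using num_unsatisfied_pos[OF \<gamma> queried_before_subset executed_infeasible[OF assms]] .
  then show False
    using greedy[OF assms] A b lt[of "real (num_unsatisfied \<gamma> P w (Q j))"]
      lt[of "total_residual \<gamma> P w (Q j)"]
    unfolding approximates_greedy_def by force
qed

lemma executed_iff: "Y j \<longleftrightarrow> G j \<noteq> {}"
  using executed_progress[of j] by (auto simp: query_set_def)

text \<open>The query sets are disjoint, so each one meeting \<open>N\<close> adds a new element of
  \<open>N\<close>. With \<open>N\<close> all intervals this gives termination; with
  \<open>N\<close> the intervals that any solution must query it gives the bound for a single
  set.\<close>

lemma executed_le_card:
  assumes "N \<subseteq> indices P"
    and "\<And>i. i < j \<Longrightarrow> G i \<inter> N \<noteq> {}"
  shows "j \<le> card (Q j \<inter> N)"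
  using assms
proof (induction j)
  case (Suc j)
  have fin: "finite (Q (Suc j) \<inter> N)" using Suc.prems(1) finite_indices finite_subset by blast
  have "Q j \<inter> N \<subset> Q (Suc j) \<inter> N"
    using Suc.prems(2)[of j] query_set_subset[of j] by (auto simp: queried_before_Suc)
  then have "card (Q j \<inter> N) < card (Q (Suc j) \<inter> N)" using fin by (intro psubset_card_mono)
  moreover have "j \<le> card (Q j \<inter> N)" using Suc by simp
  ultimately show ?case by linarith
qed simp

text \<open>Execution is downward closed and indices start at 0, so the first index not executed is
  the number of executed iterations.\<close>

definition iterations :: nat where "iterations = (LEAST j. \<not> Y j)"

lemma executed_le:
  assumes "Y j"
  shows "j \<le> num_intervals P"
proof -
  have Y: "Y i" if "i < j" for i using executed_antimono[of i j] assms that by simp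
  have "j \<le> card (Q j \<inter> indices P)"
  proof (intro executed_le_card)
    show "G i \<inter> indices P \<noteq> {}" if "i < j" for i
      using Y[OF that] executed_iff[of i] query_set_subset[of i] by blast
  qed simp
  also have "\<dots> \<le> card (indices P)" by (intro card_mono) auto
  finally show ?thesis by (simp add: indices_def)
qed

lemma executed_iff_less: "Y j \<longleftrightarrow> j < iterations"
proof
  have ex: "\<not> Y (Suc (num_intervals P))" using executed_le by fastforce
  have "\<not> Y iterations" unfolding iterations_def by (rule LeastI) (fact ex)
  then show "Y j \<Longrightarrow> j < iterations" using executed_antimono not_le by blast
  show "j < iterations \<Longrightarrow> Y j" unfolding iterations_def using not_less_Least by blast
qed

text \<open>The summation range does not depend on the realization, so expectation and sum can be
  exchanged later.\<close>

lemma sum_executed: "(\<Sum>j\<le>num_intervals P. of_bool (Y j) :: real) = real iterations"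
proof -
  have "{..num_intervals P} \<inter> {j. Y j} = {..<iterations}"
    using executed_le executed_iff_less by auto
  then show ?thesis by simp
qed

text \<open>\<open>G i\<close> lies in \<open>Q j\<close> for \<open>i < j\<close> while
  \<open>G j\<close> avoids \<open>Q j\<close>, so the query sets are disjoint; beyond
  \<open>num_intervals P\<close> they are empty.\<close>

lemma ALG_eq_sum: "ALG P \<pi> w = (\<Sum>j\<le>num_intervals P. card (G j))"
proof -
  have empty: "G j = {}" if "j > num_intervals P" for j
    using that executed_iff executed_le[of j] by fastforce
  have sub: "G i \<subseteq> Q j" if "i < j" for i j
    using that by (induction j) (auto simp: queried_before_Suc less_Suc_eq)
  have "G i \<inter> G j = {}" if "i < j" for i j
    using sub[OF that] query_set_subset[of j] by blast
  then have disj: "G i \<inter> G j = {}" if "i \<noteq> j" for i j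
    using that by (metis Int_commute linorder_neqE_nat)
  have "(\<Union>j. G j) = (\<Union>j\<le>num_intervals P. G j)"
  proof (intro equalityI UN_least)
    show "G j \<subseteq> (\<Union>j\<le>num_intervals P. G j)" for j
      using empty[of j] by (cases "j \<le> num_intervals P") auto
  qed auto
  moreover have "finite (G j)" for j
    using query_set_subset[of j] finite_indices finite_subset by blast
  ultimately show ?thesis
    unfolding ALG_def using disj by (simp add: card_UN_disjoint)
qed

text \<open>For a single set, w* = w(S), so b_S is the sum of all a_i in \<open>S\<close>; leaving
  out one positive a_i destroys feasibility. Thus \<open>N\<close> is contained in every feasible
  set, and every executed iteration takes an element of \<open>N\<close>.\<close>

lemma iterations_le_OPT_singleton_family:
  assumes "card (family P) = 1"
  shows "iterations \<le> OPT P w"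
proof -
  obtain S where S: "family P = {S}" using assms by (auto simp: card_Suc_eq)
  define N where "N = {i \<in> S. coeff_a P w i > 0}"
  have sub: "S \<subseteq> indices P" "finite S" using family_subset finite_member S by auto
  have b: "coeff_b P w S = (\<Sum>i\<in>S. coeff_a P w i)"
    by (simp add: coeff_b_def min_value_def S sum_coeff_a)
  have "iterations \<le> card (Q iterations \<inter> N)"
  proof (rule executed_le_card)
    show "N \<subseteq> indices P" using sub by (auto simp: N_def)
    show "G i \<inter> N \<noteq> {}" if i: "i < iterations" for i
    proof -
      have "Y i" using i executed_iff_less by simp
      then show ?thesis using executed_progress[of i] by (auto simp: S N_def)
    qed
  qed
  also have "\<dots> \<le> card N" using sub by (intro card_mono) (auto simp: N_def)
  also have "card N \<le> OPT P w"
  proof -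
    obtain R where R: "feasible P w R" "card R = OPT P w" by (rule OPT_attained)
    have "N \<subseteq> R"
    proof
      fix i assume i: "i \<in> N"
      show "i \<in> R"
      proof (rule ccontr)
        assume "i \<notin> R"
        then have "(\<Sum>i\<in>S \<inter> R. coeff_a P w i) < (\<Sum>i\<in>S. coeff_a P w i)"
          using i sub coeff_a_nonneg by (intro sum_strict_mono2[of _ _ i]) (auto simp: N_def)
        then show False using R(1) S b by (auto simp: feasible_def)
      qed
    qed
    moreover have "finite R" using R(1) feasible_subset_indices finite_indices finite_subset by blast
    ultimately show ?thesis using R(2) by (metis card_mono)
  qed
  finally show ?thesis .
qed

lemma iterations_le:
  assumes L: "\<lceil>ln (\<gamma> * real (card (family P)) * max_gap P)\<rceil> \<ge> 0"
    and rho: "rho_bar \<gamma> (card (family P)) (max_gap P) > 0"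
  shows "real iterations
    \<le> \<alpha> * real (OPT P w) * real_of_int (rho_bar \<gamma> (card (family P)) (max_gap P))"
proof (cases "Y 0")
  case False
  then have "iterations = 0" using executed_iff_less by blast
  then show ?thesis using \<alpha> rho by simp
next
  case True
  define k where "k = \<alpha> * real (OPT P w)"
  have OPT: "OPT P w \<ge> 1" using executed_OPT_pos[OF True] .
  then have k: "k \<ge> 1" unfolding k_def using \<alpha> mult_mono[of 1 \<alpha> 1 "real (OPT P w)"] by simp
  have "card (family P) > 0" using inst by (simp add: card_gt_0_iff minset_instance_def)
  \<comment> \<open>For \<open>m = 1\<close> the term \<lceil>ln m\<rceil> vanishes although one
    iteration may satisfy the only constraint, so the chain argument is replaced by direct
    counting.\<close>
  then consider "card (family P) = 1" | "card (family P) \<ge> 2" by linarith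
  then show ?thesis
  proof cases
    case 1
    have "real iterations \<le> real (OPT P w)" using iterations_le_OPT_singleton_family[OF 1] by simp
    also have "\<dots> \<le> k" unfolding k_def using \<alpha> by (simp add: mult_le_cancel_right1)
    \<comment> \<open>A positive integer \<open>rho_bar\<close> is at least 1.\<close>
    also have "\<dots> \<le> k * real_of_int (rho_bar \<gamma> (card (family P)) (max_gap P))"
      using rho k by (simp add: mult_le_cancel_left1)
    finally show ?thesis by (simp add: k_def)
  next
    case 2
    have mono: "Q i \<subseteq> Q j" if "i \<le> j" for i j
      using that by (induction rule: dec_induct) (auto simp: queried_before_Suc)
    have "real iterations \<le> k * real_of_int
        (\<lceil>ln (\<gamma> * real (card (family P)) * max_gap P)\<rceil> + \<lceil>ln (real (card (family P)))\<rceil>)"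
    proof (rule greedy_chain_length[OF k 2])
      show "antimono (\<lambda>j. num_unsatisfied \<gamma> P w (Q j))"
        using num_unsatisfied_antimono mono \<gamma> by (simp add: antimono_def)
      show "antimono (\<lambda>j. total_residual \<gamma> P w (Q j))"
        using total_residual_antimono mono \<gamma> by (simp add: antimono_def)
      show "total_residual \<gamma> P w (Q 0) < \<gamma> * real (card (family P)) * max_gap P"
        using total_residual_empty_less \<gamma> executed_infeasible[OF True]
        by (simp add: queried_before_0)
      fix j assume "j < iterations"
      then have "Y j" by (simp add: executed_iff_less)
      then show "num_unsatisfied \<gamma> P w (Q j) \<ge> 1"
        using num_unsatisfied_pos[OF \<gamma> queried_before_subset executed_infeasible] by simp
      show "real (num_unsatisfied \<gamma> P w (Q (Suc j)))
            \<le> (1 - 1 / k) * real (num_unsatisfied \<gamma> P w (Q j)) \<or>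
          1 \<le> total_residual \<gamma> P w (Q j) \<and>
          total_residual \<gamma> P w (Q (Suc j)) \<le> (1 - 1 / k) * total_residual \<gamma> P w (Q j)"
        using greedy[OF \<open>Y j\<close>] by (auto simp: approximates_greedy_def queried_before_Suc k_def)
    qed (use L num_unsatisfied_le in auto)
    then show ?thesis by (simp add: rho_bar_def k_def)
  qed
qed

end

section \<open>Expectations\<close>

lemma prob_space_value_law:
  assumes "value_distributions P D"
  shows "prob_space (value_law P D)"
  unfolding value_law_def
proof (rule prob_space_PiM)
  show "prob_space (D i)" if "i \<in> indices P" for i
    using assms that unfolding value_distributions_def by blast
qed

lemma space_value_law:
  assumes "value_distributions P D"
  shows "space (value_law P D) = realizations P"
proof -
  have "space (D i) = interval P i" if "i \<in> indices P" for i
  proof -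
    have "space (D i) = space (restrict_space borel (interval P i))"
      using assms that by (intro sets_eq_imp_space_eq) (auto simp: value_distributions_def)
    then show ?thesis by (simp add: space_restrict_space)
  qed
  then show ?thesis unfolding value_law_def realizations_def space_PiM by (rule PiE_cong)
qed

lemma measurable_value:
  assumes "value_distributions P D" "i \<in> indices P"
  shows "(\<lambda>w. w i) \<in> borel_measurable (value_law P D)"
proof -
  have "sets (D i) = sets (restrict_space borel (interval P i))"
    using assms by (simp add: value_distributions_def)
  moreover have "(\<lambda>x. x) \<in> borel_measurable (restrict_space borel (interval P i))"
    by (rule measurable_restrict_space1) simp
  ultimately have "(\<lambda>x. x) \<in> borel_measurable (D i)" by (simp cong: measurable_cong_sets)
  moreover have "(\<lambda>w. w i) \<in> value_law P D \<rightarrow>\<^sub>M D i"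
    unfolding value_law_def using assms(2) by (rule measurable_component_singleton)
  ultimately show ?thesis by (rule measurable_compose[rotated])
qed

text \<open>The value w* is a minimum of finitely many sums, so feasibility of a fixed set is a
  finite conjunction of measurable inequalities, and \<open>OPT\<close> is the least number
  satisfying a finite disjunction of such conditions.\<close>

lemma measurable_OPT:
  assumes inst: "minset_instance P" and D: "value_distributions P D"
  shows "(\<lambda>w. OPT P w) \<in> value_law P D \<rightarrow>\<^sub>M count_space UNIV"
proof -
  have fin: "finite (family P)" by (rule minset_instance_finite_family[OF inst])
  have sub: "S \<subseteq> indices P" if "S \<in> family P" for S
    using inst that by (auto simp: minset_instance_def)
  \<comment> \<open>The offset \<open>f\<close> covers both uses: 0 for w(S), the lower limits for
    sums of the coefficients a_i.\<close>
  have sum: "(\<lambda>w. \<Sum>i\<in>S. w i - f i) \<in> borel_measurable (value_law P D)"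
    if "S \<subseteq> indices P" for S and f :: "nat \<Rightarrow> real"
  proof (rule borel_measurable_sum)
    fix i assume "i \<in> S"
    then have [measurable]: "(\<lambda>w. w i) \<in> borel_measurable (value_law P D)"
      using that by (intro measurable_value[OF D]) auto
    show "(\<lambda>w. w i - f i) \<in> borel_measurable (value_law P D)" by measurable
  qed
  have [measurable]: "(\<lambda>w. min_value P w) \<in> borel_measurable (value_law P D)"
  proof -
    have "{(\<Sum>i\<in>S. w i) | S. S \<in> family P} = (\<lambda>S. \<Sum>i\<in>S. w i) ` family P" for w :: "nat \<Rightarrow> real"
      by auto
    then have "min_value P = (\<lambda>w. Min ((\<lambda>S. \<Sum>i\<in>S. w i) ` family P))"
      by (simp add: min_value_def fun_eq_iff)
    moreover have "(\<lambda>w. Min ((\<lambda>S. \<Sum>i\<in>S. w i) ` family P)) \<in> borel_measurable (value_law P D)"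
      using fin sub sum[of _ "\<lambda>i. 0"] by (intro borel_measurable_Min) auto
    ultimately show ?thesis by simp
  qed
  have feas: "Measurable.pred (value_law P D) (\<lambda>w. feasible P w Q)" if Q: "Q \<subseteq> indices P" for Q
  proof -
    have "Measurable.pred (value_law P D)
        (\<lambda>w. coeff_b P w S \<le> (\<Sum>i\<in>S \<inter> Q. coeff_a P w i))" for S
    proof -
      have [measurable]: "(\<lambda>w. \<Sum>i\<in>S \<inter> Q. w i - lower P i) \<in> borel_measurable (value_law P D)"
        using Q by (intro sum) auto
      have "(\<lambda>w. min_value P w - set_lower P S) \<in> borel_measurable (value_law P D)"
        by measurable
      then show ?thesis
        unfolding coeff_b_def coeff_a_def pred_def by (rule borel_measurable_le) measurable
    qed
    then show ?thesis
      unfolding feasible_def using Q fin by (auto intro!: pred_intros_finite)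
  qed
  have eq: "OPT P w = (LEAST c. \<exists>Q\<in>Pow (indices P). card Q = c \<and> feasible P w Q)"
    if "w \<in> space (value_law P D)" for w
  proof -
    interpret minset_realization P w
      using inst that space_value_law[OF D] by unfold_locales auto
    show ?thesis by (rule OPT_eq_Least)
  qed
  show ?thesis
  proof (rule measurable_cong[THEN iffD2, OF eq], assumption, rule measurable_Least)
    show "Measurable.pred (value_law P D) (\<lambda>w. \<exists>Q\<in>Pow (indices P). card Q = c \<and> feasible P w Q)" for c
    proof (rule pred_intros_finite(4))
      show "Measurable.pred (value_law P D) (\<lambda>w. card Q = c \<and> feasible P w Q)"
        if "Q \<in> Pow (indices P)" for Q
      proof -
        have [measurable]: "Measurable.pred (value_law P D) (\<lambda>w. feasible P w Q)"
          using feas that by simp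
        show ?thesis by measurable
      qed
    qed (simp add: indices_def)
  qed
qed

text \<open>E[X] = E[X | Y] Pr[Y], since X vanishes outside Y. If Pr[Y] = 0, where the assumed bound
  says nothing, X is 0 almost everywhere and both sides are 0.\<close>

lemma (in prob_space) integral_le_of_expectation_given_le:
  fixes X :: "'a \<Rightarrow> real"
  assumes [measurable]: "Measurable.pred M Y"
    and zero: "\<And>\<omega>. \<omega> \<in> space M \<Longrightarrow> \<not> Y \<omega> \<Longrightarrow> X \<omega> = 0"
    and le: "measure M {\<omega> \<in> space M. Y \<omega>} > 0 \<Longrightarrow> expectation_given M X Y \<le> \<beta>"
  shows "(\<integral>\<omega>. X \<omega> \<partial>M) \<le> \<beta> * measure M {\<omega> \<in> space M. Y \<omega>}"
proof -
  have X: "(\<integral>\<omega>. X \<omega> \<partial>M) = (\<integral>\<omega>. X \<omega> * of_bool (Y \<omega>) \<partial>M)"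
    using zero by (intro Bochner_Integration.integral_cong) auto
  show ?thesis
  proof (cases "measure M {\<omega> \<in> space M. Y \<omega>} > 0")
    case True
    then show ?thesis using le X by (simp add: expectation_given_def pos_divide_le_eq)
  next
    case False
    then have 0: "prob {\<omega> \<in> space M. Y \<omega>} = 0" by (simp add: measure_le_0_iff not_less)
    then have "AE \<omega> in M. \<not> Y \<omega>"
      by (subst (asm) prob_Collect_eq_0) auto
    then have "AE \<omega> in M. X \<omega> = 0" using AE_space by eventually_elim (auto simp: zero)
    then have "(\<integral>\<omega>. X \<omega> \<partial>M) = 0" by (rule integral_eq_zero_AE)
    then show ?thesis using 0 by simp
  qed
qed

text \<open>The first logarithm is \<open>ln (\<gamma> * d) + ln m\<close>; from
  \<open>m = 3\<close> on \<open>ln m \<ge> 1\<close> absorbs the constant part and the two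
  roundings, which account for the 2 in \<open>C\<close>.\<close>

lemma rho_bar_bigo:
  fixes c \<gamma> d :: real
  assumes "\<gamma> > 0" "d > 0"
  shows "(\<lambda>m. c * real_of_int (rho_bar \<gamma> m d)) \<in> O(\<lambda>m. c * ln (real m))"
proof -
  define C where "C = \<bar>ln (\<gamma> * d)\<bar> + 2"
  have "\<forall>\<^sub>F m in at_top. norm (real_of_int (rho_bar \<gamma> m d)) \<le> (C + 2) * norm (ln (real m))"
    using eventually_ge_at_top[of 3]
  proof eventually_elim
    case (elim m)
    have ln1: "1 \<le> ln (real m)" using elim e_less_272 by (subst ln_ge_iff) auto
    have "C * 1 \<le> C * ln (real m)" using ln1 by (intro mult_left_mono) (auto simp: C_def)
    then have C: "C \<le> C * ln (real m)" by simp
    have ceil: "\<bar>real_of_int \<lceil>x\<rceil>\<bar> \<le> \<bar>x\<bar> + 1" for x :: real by linarith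
    have "ln (\<gamma> * real m * d) = ln (\<gamma> * d * real m)" by (simp add: mult_ac)
    also have "\<dots> = ln (\<gamma> * d) + ln (real m)" using assms elim by (intro ln_mult_pos) auto
    finally have "\<bar>real_of_int \<lceil>ln (\<gamma> * real m * d)\<rceil>\<bar> \<le> C - 1 + ln (real m)"
      using ceil[of "ln (\<gamma> * real m * d)"] ln1 unfolding C_def by linarith
    then have "\<bar>real_of_int (rho_bar \<gamma> m d)\<bar> \<le> C + 2 * ln (real m)"
      using ceil[of "ln (real m)"] ln1 unfolding rho_bar_def by linarith
    then show ?case using C ln1 by (simp add: distrib_right)
  qed
  then have "(\<lambda>m. real_of_int (rho_bar \<gamma> m d)) \<in> O(\<lambda>m. ln (real m))" by (rule bigoI)
  then show ?thesis by (rule landau_o.big.mult_left)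
qed

section \<open>Expected number of queries and its asymptotic form\<close>

theorem theorem6:
  fixes \<alpha> \<beta> \<gamma> :: real
    and P :: minset
    and D :: "nat \<Rightarrow> real measure"
    and \<pi> :: algorithm
  assumes "\<alpha> \<ge> 1" and "\<beta> > 0" and "\<gamma> > 0"
    and "minset_instance P"
    and "value_distributions P D"
    and "greedy_algorithm \<alpha> \<beta> \<gamma> P D \<pi>"
    and "\<lceil>ln (\<gamma> * real (card (family P)) * max_gap P)\<rceil> \<ge> 0"
    and "rho_bar \<gamma> (card (family P)) (max_gap P) > 0"
  shows "(\<integral>w. real (ALG P \<pi> w) \<partial>value_law P D)
           \<le> \<alpha> * \<beta> * real_of_int (rho_bar \<gamma> (card (family P)) (max_gap P))
               * (\<integral>w. real (OPT P w) \<partial>value_law P D)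
         \<and> (\<forall>d>0. (\<lambda>m. \<alpha> * \<beta> * real_of_int (rho_bar \<gamma> m d)) \<in> O(\<lambda>m. \<alpha> * \<beta> * ln (real m)))"
proof (intro conjI allI impI)
  define M where "M = value_law P D"
  define n where "n = num_intervals P"
  define \<rho> where "\<rho> = real_of_int (rho_bar \<gamma> (card (family P)) (max_gap P))"
  interpret prob_space M unfolding M_def by (rule prob_space_value_law[OF assms(5)])
  note greedy = assms(6)[unfolded greedy_algorithm_def]
  have space: "space M = realizations P" unfolding M_def by (rule space_value_law[OF assms(5)])
  have loc: "greedy_realization P w \<pi> \<alpha> \<gamma>" if "w \<in> space M" for w
    using that assms(1,3,4) greedy space by unfold_locales auto
  have G [measurable]: "(\<lambda>w. query_set P \<pi> w j) \<in> M \<rightarrow>\<^sub>M count_space UNIV" for j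
    using greedy by (simp add: M_def)
  have OPT [measurable]: "(\<lambda>w. OPT P w) \<in> M \<rightarrow>\<^sub>M count_space UNIV"
    unfolding M_def by (rule measurable_OPT[OF assms(4,5)])
  \<comment> \<open>Executed iterations query something, so \<open>executed\<close> inherits measurability from \<open>query_set\<close>.\<close>
  have Y: "Measurable.pred M (\<lambda>w. executed P \<pi> w j)" for j
  proof -
    have eq: "executed P \<pi> w j \<longleftrightarrow> query_set P \<pi> w j \<noteq> {}" if "w \<in> space M" for w
      by (rule greedy_realization.executed_iff[OF loc[OF that]])
    show ?thesis by (rule measurable_cong[THEN iffD2, OF eq]) measurable
  qed
  have card_le: "card (query_set P \<pi> w j) \<le> n" if "w \<in> space M" for w j
  proof -
    have "query_set P \<pi> w j \<subseteq> indices P" using greedy_realization.query_set_subset[OF loc[OF that]] by blast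
    then have "card (query_set P \<pi> w j) \<le> card (indices P)" by (intro card_mono) (auto simp: indices_def)
    then show ?thesis by (simp add: indices_def n_def)
  qed
  have int_G: "integrable M (\<lambda>w. real (card (query_set P \<pi> w j)))" for j
    by (rule integrable_const_bound[where B = "real n"]) (auto intro!: AE_I2 card_le)
  have int_Y: "integrable M (\<lambda>w. of_bool (executed P \<pi> w j) :: real)" for j
    using Y by (intro integrable_const_bound[where B = 1]) auto
  have int_OPT: "integrable M (\<lambda>w. real (OPT P w))"
  proof (rule integrable_const_bound[where B = "real n"])
    show "AE w in M. norm (real (OPT P w)) \<le> real n"
    proof (rule AE_I2)
      fix w assume "w \<in> space M"
      then interpret greedy_realization P w \<pi> \<alpha> \<gamma> by (rule loc)
      show "norm (real (OPT P w)) \<le> real n" using OPT_le_num_intervals by (simp add: n_def)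
    qed
  qed simp
  have prob_Y: "(\<integral>w. of_bool (executed P \<pi> w j) \<partial>M) = prob {w \<in> space M. executed P \<pi> w j}" for j
  proof -
    have "(\<integral>w. of_bool (executed P \<pi> w j) \<partial>M)
        = (\<integral>w. indicator {w \<in> space M. executed P \<pi> w j} w \<partial>M)"
      by (intro Bochner_Integration.integral_cong) (auto simp: indicator_def)
    also have "\<dots> = prob ({w \<in> space M. executed P \<pi> w j} \<inter> space M)" by simp
    also have "{w \<in> space M. executed P \<pi> w j} \<inter> space M = {w \<in> space M. executed P \<pi> w j}" by blast
    finally show ?thesis .
  qed

  have "(\<integral>w. real (ALG P \<pi> w) \<partial>M) = (\<integral>w. (\<Sum>j\<le>n. real (card (query_set P \<pi> w j))) \<partial>M)"
    using greedy_realization.ALG_eq_sum[OF loc]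
    by (intro Bochner_Integration.integral_cong) (auto simp: n_def)
  also have "\<dots> = (\<Sum>j\<le>n. \<integral>w. real (card (query_set P \<pi> w j)) \<partial>M)"
    using int_G by (intro Bochner_Integration.integral_sum)
  \<comment> \<open>The bound on conditional expectations is applied to each iteration separately,
    so dependence between iterations is harmless.\<close>
  also have "\<dots> \<le> (\<Sum>j\<le>n. \<beta> * prob {w \<in> space M. executed P \<pi> w j})"
    using Y greedy
    by (intro sum_mono integral_le_of_expectation_given_le) (auto simp: M_def query_set_def)
  also have "\<dots> = \<beta> * (\<integral>w. (\<Sum>j\<le>n. of_bool (executed P \<pi> w j)) \<partial>M)"
    unfolding Bochner_Integration.integral_sum[OF int_Y] prob_Y by (rule sum_distrib_left[symmetric])
  \<comment> \<open>The number of iterations is compared with \<open>OPT\<close> pointwise,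
    realization by realization, before integrating.\<close>
  also have "\<dots> \<le> \<beta> * (\<integral>w. \<alpha> * \<rho> * real (OPT P w) \<partial>M)"
  proof (intro mult_left_mono integral_mono)
    fix w assume "w \<in> space M"
    then interpret greedy_realization P w \<pi> \<alpha> \<gamma> by (rule loc)
    show "(\<Sum>j\<le>n. of_bool (executed P \<pi> w j)) \<le> \<alpha> * \<rho> * real (OPT P w)"
      using iterations_le[OF assms(7,8)] sum_executed by (simp add: n_def \<rho>_def mult_ac)
  next
    show "integrable M (\<lambda>w. \<Sum>j\<le>n. of_bool (executed P \<pi> w j) :: real)"
      by (rule Bochner_Integration.integrable_sum) (rule int_Y)
  qed (use int_OPT assms(2) in auto)
  finally show "(\<integral>w. real (ALG P \<pi> w) \<partial>value_law P D)
      \<le> \<alpha> * \<beta> * real_of_int (rho_bar \<gamma> (card (family P)) (max_gap P))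
          * (\<integral>w. real (OPT P w) \<partial>value_law P D)"
    using assms(2) by (simp add: M_def \<rho>_def mult_ac)
next
  fix d :: real assume "d > 0"
  then show "(\<lambda>m. \<alpha> * \<beta> * real_of_int (rho_bar \<gamma> m d)) \<in> O(\<lambda>m. \<alpha> * \<beta> * ln (real m))"
    by (rule rho_bar_bigo[OF assms(3)])
qed

end
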